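(* For any positive integer $k$, the number of ODD colored compositions of $k$ is equal to $$\sum_{w}\ \prod_{r} |r|,$$ where the sum is over all binary strings $w\in\{0,1\}^k$ of length $k$ whose first digit is $1$, and for each such $w$ the product is over all runs $r$ of $1$'s in $w$, with $|r|$ denoting the length of the run $r$.
   Context: A composition of a positive integer $k$ is a finite ordered sequence of positive integers (called parts) whose sum is $k$; positions of parts are numbered $1,2,3,\dots$ from left to right. An ODD colored composition of $k$ is a composition of $k$ in which each part in an odd position (1st, 3rd, ...) of size $p$ is given one of $p$ colors $1,\dots,p$, while the parts in even positions are not colored. A run of $1$'s in a binary string is a maximal nonempty contiguous block of $1$'s. *)

theory Defs
  imports Main
begin

definition composition :: "nat \<Rightarrow> nat list \<Rightarrow> bool" where
  "composition k ps \<longleftrightarrow> (\<forall>p \<in> set ps. 0 < p) \<and> sum_list ps = k"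

text \<open>
  A colored composition is a list of parts paired with an optional color, \<^term>\<open>None\<close> meaning
  that the part is not colored. Positions are numbered from 1, so the part in position
  \<open>i + 1\<close> is the list entry with index \<open>i\<close>.
\<close>

definition odd_colored_composition :: "nat \<Rightarrow> (nat \<times> nat option) list \<Rightarrow> bool" where
  "odd_colored_composition k xs \<longleftrightarrow>
     composition k (map fst xs) \<and>
     (\<forall>i < length xs.
        if odd (i + 1) then \<exists>c \<in> {1..fst (xs ! i)}. snd (xs ! i) = Some c
        else snd (xs ! i) = None)"

definition binary_strings :: "nat \<Rightarrow> nat list set" where
  "binary_strings k = {w. length w = k \<and> set w \<subseteq> {0, 1}}"

text \<open>Blocks and runs are identified with their sets of (0-based) indices in the string.\<close>

definition ones_block :: "nat list \<Rightarrow> nat set \<Rightarrow> bool" where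
  "ones_block w r \<longleftrightarrow>
     (\<exists>i j. i < j \<and> j \<le> length w \<and> r = {i..<j}) \<and> (\<forall>m \<in> r. w ! m = 1)"

definition runs :: "nat list \<Rightarrow> nat set set" where
  "runs w = {r. ones_block w r \<and> (\<forall>s. ones_block w s \<and> r \<subseteq> s \<longrightarrow> s = r)}"

end

theory Submission
  imports Defs
begin

text \<open>
  A binary string starting with 1 is determined by the lengths of its maximal constant blocks,
  which form a composition; the blocks of 1's are those in odd positions. Hence the product of
  the lengths of the runs of 1's is the product of the parts in odd positions, and this is the
  number of ways to color the composition.
\<close>

section \<open>Runs as intervals\<close>

definition maximal_ones :: "nat list \<Rightarrow> nat \<Rightarrow> nat \<Rightarrow> bool" where
  "maximal_ones w i j \<longleftrightarrow> i < j \<and> j \<le> length w \<and> (\<forall>m. i \<le> m \<and> m < j \<longrightarrow> w ! m = 1) \<and>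
     (\<forall>m. Suc m = i \<longrightarrow> w ! m \<noteq> 1) \<and> (j < length w \<longrightarrow> w ! j \<noteq> 1)"

text \<open>Maximality is local: a block of 1's that can be enlarged at all can be enlarged by an
  adjacent index, so only the two neighbours matter. Writing the left neighbour as
  \<open>Suc m = i\<close> makes its condition vacuous at \<open>i = 0\<close>, where
  \<open>i - 1\<close> would be 0.\<close>

lemma runs_eq_maximal_ones: "runs w = {{i..<j} |i j. maximal_ones w i j}"
proof (intro set_eqI iffI)
  fix r assume "r \<in> runs w"
  then have block: "ones_block w r" and max: "\<And>s. ones_block w s \<Longrightarrow> r \<subseteq> s \<Longrightarrow> s = r"
    by (auto simp: runs_def)
  from block obtain i j where ij: "i < j" "j \<le> length w" "r = {i..<j}" and ones: "\<forall>m\<in>r. w ! m = 1"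
    by (auto simp: ones_block_def)
  have "w ! m \<noteq> 1" if "Suc m = i" for m
  proof
    assume "w ! m = 1"
    with that ij ones have "ones_block w {m..<j}"
      unfolding ones_block_def by (metis atLeastLessThan_iff le_neq_implies_less Suc_leI Suc_lessD)
    moreover have "r \<subseteq> {m..<j}" "m \<in> {m..<j}" "m \<notin> r" using that ij by auto
    ultimately show False using max by blast
  qed
  moreover have "w ! j \<noteq> 1" if "j < length w"
  proof
    assume "w ! j = 1"
    with that ij ones have "ones_block w {i..<Suc j}"
      unfolding ones_block_def
      by (metis atLeastLessThan_iff less_Suc_eq Suc_leI)
    moreover have "r \<subseteq> {i..<Suc j}" "j \<in> {i..<Suc j}" "j \<notin> r" using ij by auto
    ultimately show False using max by blast
  qed
  ultimately have "maximal_ones w i j"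
    using ij ones by (simp add: maximal_ones_def)
  with ij show "r \<in> {{i..<j} |i j. maximal_ones w i j}" by blast
next
  fix r assume "r \<in> {{i..<j} |i j. maximal_ones w i j}"
  then obtain i j where r: "r = {i..<j}" and max: "maximal_ones w i j" by blast
  have "s = r" if "ones_block w s" "r \<subseteq> s" for s
  proof -
    from that(1) obtain a b where s: "s = {a..<b}" "b \<le> length w" and ones: "\<forall>m\<in>s. w ! m = 1"
      by (auto simp: ones_block_def)
    have ab: "a \<le> i" "j \<le> b" using that(2) max r s by (auto simp: maximal_ones_def)
    have "\<not> a < i"
    proof
      assume "a < i"
      then obtain m where "Suc m = i" by (cases i) auto
      with \<open>a < i\<close> ab s ones max show False by (auto simp: maximal_ones_def)
    qed
    moreover have "\<not> j < b"
      using ab s ones max by (auto simp: maximal_ones_def)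
    ultimately show ?thesis using ab r s by simp
  qed
  moreover have "ones_block w r"
    using max r by (auto simp: maximal_ones_def ones_block_def)
  ultimately show "r \<in> runs w" by (auto simp: runs_def)
qed

lemma finite_runs: "finite (runs w)"
  by (rule finite_subset[of _ "Pow {..<length w}"])
    (auto simp: runs_eq_maximal_ones maximal_ones_def)

section \<open>Splitting off the first block of a word\<close>

text \<open>Only the left boundary at \<open>i = 0\<close> is affected: there the prefix, if
  nonempty, supplies a new left neighbour \<open>x\<close>. But 1's at the start of \<open>v\<close>
  force \<open>hd v = 1\<close>, hence \<open>x \<noteq> 1\<close>.\<close>

lemma maximal_ones_shift:
  assumes "v = [] \<or> hd v \<noteq> x"
  shows "maximal_ones (replicate p x @ v) (p + i) (p + j) \<longleftrightarrow> maximal_ones v i j"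
proof -
  have v0: "v ! 0 \<noteq> x" if "0 < length v" using assms that by (cases v) auto
  have "(\<forall>m. p + i \<le> m \<and> m < p + j \<longrightarrow> (replicate p x @ v) ! m = 1) \<longleftrightarrow>
      (\<forall>m. i \<le> m \<and> m < j \<longrightarrow> v ! m = 1)" (is "?A \<longleftrightarrow> ?B")
  proof
    assume A: ?A
    show ?B
    proof (intro allI impI)
      fix m assume "i \<le> m \<and> m < j"
      then show "v ! m = 1" using A[rule_format, of "p + m"] by (simp add: nth_append)
    qed
  next
    assume B: ?B
    show ?A
    proof (intro allI impI)
      fix m assume "p + i \<le> m \<and> m < p + j"
      then have "\<not> m < p" "i \<le> m - p \<and> m - p < j" by auto
      then show "(replicate p x @ v) ! m = 1" using B by (simp add: nth_append)
    qed
  qed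
  \<comment> \<open>Taken alone, the left boundary conditions can differ at \<open>i = 0\<close>, so
    they are compared under other clauses of \<open>maximal_ones v i j\<close>.\<close>
  moreover have "(\<forall>m. Suc m = p + i \<longrightarrow> (replicate p x @ v) ! m \<noteq> 1) \<longleftrightarrow>
      (\<forall>m. Suc m = i \<longrightarrow> v ! m \<noteq> 1)" if "i < j" "j \<le> length v" "\<forall>m. i \<le> m \<and> m < j \<longrightarrow> v ! m = 1"
  proof (cases i)
    case 0
    then have "v ! 0 = 1" "0 < length v" using that by auto
    then have "x \<noteq> 1" using v0 by blast
    then show ?thesis using 0 by (auto simp: nth_append)
  qed (auto simp: nth_append)
  ultimately show ?thesis
    unfolding maximal_ones_def by (auto simp: nth_append)
qed

text \<open>An entry inside the prefix is \<open>x\<close>, so \<open>x = 1\<close>; maximality then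
  pushes both ends to the ends of the prefix, and the change of letter at \<open>p\<close> prevents
  going further.\<close>

lemma maximal_ones_start:
  assumes "v = [] \<or> hd v \<noteq> x" "i < p"
  shows "maximal_ones (replicate p x @ v) i j \<longleftrightarrow> x = 1 \<and> i = 0 \<and> j = p"
proof
  assume max: "maximal_ones (replicate p x @ v) i j"
  then have x: "x = 1" using assms(2) by (auto simp: maximal_ones_def nth_append)
  have "i = 0"
  proof (cases i)
    case (Suc m)
    with max assms(2) x show ?thesis by (auto simp: maximal_ones_def nth_append)
  qed
  moreover have "\<not> j < p"
    using max x by (auto simp: maximal_ones_def nth_append)
  moreover have "\<not> p < j"
  proof
    assume "p < j"
    with max assms(2) have "(replicate p x @ v) ! p = 1" "v \<noteq> []"
      by (auto simp: maximal_ones_def)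
    with assms(1) x show False by (simp add: nth_append hd_conv_nth)
  qed
  ultimately show "x = 1 \<and> i = 0 \<and> j = p" using x by simp
next
  assume "x = 1 \<and> i = 0 \<and> j = p"
  with assms show "maximal_ones (replicate p x @ v) i j"
    by (auto simp: maximal_ones_def nth_append hd_conv_nth)
qed

text \<open>The cases are a run starting before \<open>p\<close> and one starting at or after
  \<open>p\<close>; the change of letter keeps the prefix from merging with a run of
  \<open>v\<close>.\<close>

lemma runs_replicate_append:
  assumes "v = [] \<or> hd v \<noteq> x" "0 < p"
  shows "runs (replicate p x @ v) =
    (if x = 1 then {{0..<p}} else {}) \<union> image ((+) p) ` runs v" (is "?L = ?R")
proof (intro set_eqI iffI)
  fix r assume "r \<in> ?L"
  then obtain i j where r: "r = {i..<j}" and max: "maximal_ones (replicate p x @ v) i j"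
    by (auto simp: runs_eq_maximal_ones)
  show "r \<in> ?R"
  proof (cases "i < p")
    case True
    then show ?thesis using max maximal_ones_start[OF assms(1) True] r by simp
  next
    case False
    moreover have "i < j" using max by (simp add: maximal_ones_def)
    ultimately have "i = p + (i - p)" "j = p + (j - p)" by auto
    then obtain i' j' where ij: "i = p + i'" "j = p + j'" by blast
    then have "maximal_ones v i' j'" using max maximal_ones_shift[OF assms(1)] by simp
    then have "{i'..<j'} \<in> runs v" by (auto simp: runs_eq_maximal_ones)
    moreover have "r = (+) p ` {i'..<j'}" by (simp add: r ij add.commute)
    ultimately show ?thesis by blast
  qed
next
  fix r assume "r \<in> ?R"
  then consider "x = 1" "r = {0..<p}" | s where "s \<in> runs v" "r = (+) p ` s"
    by (auto split: if_splits)
  then show "r \<in> ?L"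
  proof cases
    case 1
    \<comment> \<open>Here \<open>0 < p\<close> plays the premise \<open>i < p\<close> with
      \<open>i = 0\<close>, and \<open>j\<close> is \<open>p\<close>.\<close>
    then show ?thesis using maximal_ones_start[OF assms, of p] by (auto simp: runs_eq_maximal_ones)
  next
    case 2
    then obtain i j where "s = {i..<j}" "maximal_ones v i j" by (auto simp: runs_eq_maximal_ones)
    then have "maximal_ones (replicate p x @ v) (p + i) (p + j)" "r = {p + i..<p + j}"
      using 2 by (simp_all add: maximal_ones_shift[OF assms(1)]) (simp add: add.commute)
    then show ?thesis by (auto simp: runs_eq_maximal_ones)
  qed
qed

lemma prod_card_runs_replicate_append:
  assumes "v = [] \<or> hd v \<noteq> x" "0 < p"
  shows "(\<Prod>r\<in>runs (replicate p x @ v). card r) = (if x = 1 then p else 1) * (\<Prod>r\<in>runs v. card r)"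
proof -
  have "inj_on (image ((+) p)) (runs v)"
    by (auto simp: inj_on_def inj_image_eq_iff)
  then have shift: "(\<Prod>r\<in>image ((+) p) ` runs v. card r) = (\<Prod>r\<in>runs v. card r)"
    by (simp add: prod.reindex card_image)
  \<comment> \<open>The new run contains 0 and no translate by \<open>p > 0\<close> does, so it
    contributes a separate factor.\<close>
  have "{0..<p} \<notin> image ((+) p) ` runs v"
  proof
    assume "{0..<p} \<in> image ((+) p) ` runs v"
    then obtain s where "{0..<p} = (+) p ` s" by blast
    moreover have "0 \<in> {0..<p}" using assms(2) by simp
    ultimately show False using assms(2) by auto
  qed
  then show ?thesis
    by (simp add: runs_replicate_append[OF assms] shift finite_runs)
qed

section \<open>Words with prescribed block lengths\<close>

fun alternating_word :: "bool \<Rightarrow> nat list \<Rightarrow> nat list" where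
  "alternating_word b [] = []"
| "alternating_word b (p # ps) = replicate p (of_bool b) @ alternating_word (\<not> b) ps"

text \<open>Flipping \<open>b\<close> at each part turns the parity of positions into structural
  recursion; for \<open>b = True\<close> this is the product of the parts in odd positions.\<close>

fun alternating_prod :: "bool \<Rightarrow> nat list \<Rightarrow> nat" where
  "alternating_prod b [] = 1"
| "alternating_prod b (p # ps) = (if b then p else 1) * alternating_prod (\<not> b) ps"

lemma length_alternating_word: "length (alternating_word b ps) = sum_list ps"
  by (induction ps arbitrary: b) auto

lemma set_alternating_word: "set (alternating_word b ps) \<subseteq> {0, 1}"
  by (induction ps arbitrary: b) (auto split: if_splits)

text \<open>Positivity matters: after a first part 0, the head would come from a later block,
  possibly of the other letter.\<close>

lemma hd_alternating_word:
  assumes "\<forall>p\<in>set ps. 0 < p"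
  shows "alternating_word b ps = [] \<or> hd (alternating_word b ps) = of_bool b"
  using assms by (cases ps) (auto simp: hd_append)

text \<open>Supplies the side condition \<open>v = [] \<or> hd v \<noteq> x\<close> of the lemmas
  that split off a block.\<close>

lemma hd_alternating_word_Not:
  assumes "\<forall>p\<in>set ps. 0 < p"
  shows "alternating_word (\<not> b) ps = [] \<or> hd (alternating_word (\<not> b) ps) \<noteq> of_bool b"
  using hd_alternating_word[OF assms, of "\<not> b"] by auto

lemma prod_card_runs_alternating_word:
  assumes "\<forall>p\<in>set ps. 0 < p"
  shows "(\<Prod>r\<in>runs (alternating_word b ps). card r) = alternating_prod b ps"
  using assms
proof (induction ps arbitrary: b)
  case Nil
  then show ?case by (simp add: runs_eq_maximal_ones maximal_ones_def)
next
  case (Cons p ps)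
  then show ?case
    using prod_card_runs_replicate_append[OF hd_alternating_word_Not, of ps p b] by simp
qed

section \<open>Compositions and binary words with a given first letter\<close>

lemma takeWhile_replicate_append:
  assumes "v = [] \<or> hd v \<noteq> x"
  shows "takeWhile (\<lambda>y. y = x) (replicate p x @ v) = replicate p x"
proof (induction p)
  case 0
  then show ?case using assms by (cases v) auto
qed simp

text \<open>The first part is recovered as the length of the longest prefix of letters
  \<open>of_bool b\<close>; the rest follows by induction with the flag flipped.\<close>

lemma alternating_word_inject:
  assumes "\<forall>p\<in>set ps. 0 < p" "\<forall>q\<in>set qs. 0 < q" "alternating_word b ps = alternating_word b qs"
  shows "ps = qs"
  using assms
proof (induction ps arbitrary: b qs)
  case Nil
  then show ?case by (cases qs) auto
next
  case (Cons p ps)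
  \<comment> \<open>Since \<open>0 < p\<close>, the common word is nonempty, so \<open>qs\<close> is
    too.\<close>
  then obtain q qs' where qs: "qs = q # qs'" by (cases qs) auto
  have eq: "replicate p (of_bool b) @ alternating_word (\<not> b) ps =
      replicate q (of_bool b) @ alternating_word (\<not> b) qs'"
    using Cons.prems(3) qs by simp
  have "takeWhile (\<lambda>y. y = of_bool b) (replicate p (of_bool b) @ alternating_word (\<not> b) ps) =
      replicate p (of_bool b)"
    using Cons.prems by (intro takeWhile_replicate_append hd_alternating_word_Not) auto
  moreover have "takeWhile (\<lambda>y. y = of_bool b) (replicate q (of_bool b) @ alternating_word (\<not> b) qs') =
      replicate q (of_bool b)"
    using Cons.prems qs by (intro takeWhile_replicate_append hd_alternating_word_Not) auto
  ultimately have "replicate p (of_bool b :: nat) = replicate q (of_bool b)" using eq by simp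
  then have "p = q" by (metis length_replicate)
  with eq qs Cons show ?case by auto
qed

text \<open>Cut \<open>w\<close> at its first change of letter. The induction is on length because a
  whole block is removed at once.\<close>

lemma alternating_word_surj:
  assumes "set w \<subseteq> {0, 1}" "w = [] \<or> hd w = of_bool b"
  shows "\<exists>ps. (\<forall>p\<in>set ps. 0 < p) \<and> alternating_word b ps = w"
  using assms
proof (induction w arbitrary: b rule: length_induct)
  case (1 w)
  show ?case
  proof (cases "w = []")
    case True
    then show ?thesis by (intro exI[of _ "[]"]) simp
  next
    case False
    define x :: nat where "x = of_bool b"
    define u where "u = takeWhile (\<lambda>y. y = x) w"
    define v where "v = dropWhile (\<lambda>y. y = x) w"
    have w: "w = u @ v" by (simp add: u_def v_def)
    have u: "u = replicate (length u) x"
      using set_takeWhileD[of _ "\<lambda>y. y = x" w] unfolding u_def by (metis replicate_eqI)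
    \<comment> \<open>This makes the new part positive and \<open>v\<close> shorter than
      \<open>w\<close>.\<close>
    moreover have "u \<noteq> []" using False 1(3) by (cases w) (auto simp: u_def x_def)
    moreover have "set v \<subseteq> {0, 1}" using 1(2) w by auto
    moreover have "v = [] \<or> hd v = of_bool (\<not> b)"
    proof (cases "v = []")
      case False
      then have "hd v \<noteq> x" using hd_dropWhile[of "\<lambda>y. y = x" w] by (simp add: v_def)
      moreover have "hd v \<in> {0, 1}" using \<open>set v \<subseteq> {0, 1}\<close> False by (meson hd_in_set subsetD)
      ultimately show ?thesis by (auto simp: x_def split: if_splits)
    qed simp
    ultimately obtain ps where "\<forall>p\<in>set ps. 0 < p" "alternating_word (\<not> b) ps = v"
      using 1(1) w by (metis length_append length_greater_0_conv less_add_same_cancel2)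
    with w u \<open>u \<noteq> []\<close> show ?thesis
      by (intro exI[of _ "length u # ps"]) (auto simp: x_def)
  qed
qed

text \<open>With \<open>0 < k\<close> the words are nonempty, so \<open>hd w\<close> is a genuine
  first letter and not the unspecified \<open>hd []\<close>.\<close>

lemma bij_betw_alternating_word:
  assumes "0 < k"
  shows "bij_betw (alternating_word b) {ps. composition k ps}
    {w \<in> binary_strings k. hd w = of_bool b}"
proof (rule bij_betw_imageI)
  show "inj_on (alternating_word b) {ps. composition k ps}"
    using alternating_word_inject by (auto simp: inj_on_def composition_def)
  show "alternating_word b ` {ps. composition k ps} = {w \<in> binary_strings k. hd w = of_bool b}"
  proof (intro set_eqI iffI)
    fix w assume "w \<in> alternating_word b ` {ps. composition k ps}"
    then obtain ps where ps: "composition k ps" "w = alternating_word b ps" by auto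
    then have "length w = k" by (simp add: composition_def length_alternating_word)
    then show "w \<in> {w \<in> binary_strings k. hd w = of_bool b}"
      using ps set_alternating_word[of b ps] hd_alternating_word[of ps b] assms
      by (auto simp: composition_def binary_strings_def)
  next
    fix w assume "w \<in> {w \<in> binary_strings k. hd w = of_bool b}"
    then have w: "length w = k" "set w \<subseteq> {0, 1}" "hd w = of_bool b"
      by (auto simp: binary_strings_def)
    then obtain ps where "\<forall>p\<in>set ps. 0 < p" "alternating_word b ps = w"
      using alternating_word_surj by blast
    then show "w \<in> alternating_word b ` {ps. composition k ps}"
      using w length_alternating_word[of b ps] by (auto simp: composition_def)
  qed
qed

lemma finite_binary_strings: "finite (binary_strings k)"
  using finite_lists_length_eq[of "{0, 1 :: nat}" k]
  by (simp add: binary_strings_def conj_commute)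

section \<open>Colorings of a fixed composition\<close>

definition colorings :: "bool \<Rightarrow> nat list \<Rightarrow> (nat \<times> nat option) list set" where
  "colorings b ps = {xs. map fst xs = ps \<and>
     (\<forall>i < length xs.
        if even i = b then \<exists>c \<in> {1..fst (xs ! i)}. snd (xs ! i) = Some c
        else snd (xs ! i) = None)}"

text \<open>Removing the head lowers every index by one and swaps parities, which is why
  \<open>colorings\<close> carries a flag. For \<open>b = True\<close> the colored indices 0, 2, ...
  are the positions 1, 3, ...\<close>

lemma colorings_Cons:
  "colorings b (p # ps) = (\<lambda>(c, xs). (p, c) # xs) `
     ((if b then Some ` {1..p} else {None}) \<times> colorings (\<not> b) ps)" (is "?L = ?R")
proof (intro set_eqI iffI)
  fix ys assume "ys \<in> ?L"
  then obtain c xs where ys: "ys = (p, c) # xs" and xs: "map fst xs = ps"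
    and col: "\<forall>i < Suc (length xs).
        if even i = b then \<exists>c \<in> {1..fst (ys ! i)}. snd (ys ! i) = Some c
        else snd (ys ! i) = None"
    by (auto simp: colorings_def map_eq_Cons_conv)
  have "c \<in> (if b then Some ` {1..p} else {None})"
    using col[rule_format, of 0] ys by (auto split: if_splits)
  moreover have "xs \<in> colorings (\<not> b) ps"
    unfolding colorings_def
  proof (intro CollectI conjI allI impI xs)
    fix i assume "i < length xs"
    then show "if even i = (\<not> b) then \<exists>c \<in> {1..fst (xs ! i)}. snd (xs ! i) = Some c
        else snd (xs ! i) = None"
      using col[rule_format, of "Suc i"] ys by (auto split: if_splits)
  qed
  ultimately show "ys \<in> ?R" using ys by auto
next
  fix ys assume "ys \<in> ?R"
  then obtain c xs where ys: "ys = (p, c) # xs" and c: "c \<in> (if b then Some ` {1..p} else {None})"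
    and xs: "xs \<in> colorings (\<not> b) ps" by auto
  show "ys \<in> ?L"
    unfolding colorings_def
  proof (intro CollectI conjI allI impI)
    show "map fst ys = p # ps" using ys xs by (simp add: colorings_def)
    fix i assume "i < length ys"
    then show "if even i = b then \<exists>c \<in> {1..fst (ys ! i)}. snd (ys ! i) = Some c
        else snd (ys ! i) = None"
      using ys c xs by (cases i) (auto simp: colorings_def split: if_splits)
  qed
qed

lemma finite_colorings: "finite (colorings b ps)"
proof (induction ps arbitrary: b)
  case Nil
  then show ?case by (simp add: colorings_def)
qed (simp add: colorings_Cons)

text \<open>The head has \<open>p\<close> choices or only \<open>None\<close>, independently of the
  tail, which is the recursion of \<open>alternating_prod\<close>.\<close>

lemma card_colorings: "card (colorings b ps) = alternating_prod b ps"
proof (induction ps arbitrary: b)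
  case Nil
  have "colorings b [] = {[]}" by (auto simp: colorings_def)
  then show ?case by simp
next
  case (Cons p ps)
  have "inj_on (\<lambda>(c, xs). (p, c) # xs)
      ((if b then Some ` {1..p} else {None}) \<times> colorings (\<not> b) ps)"
    by (auto simp: inj_on_def)
  then have "card (colorings b (p # ps)) =
      card ((if b then Some ` {1..p} else {None}) \<times> colorings (\<not> b) ps)"
    unfolding colorings_Cons by (rule card_image)
  then show ?case by (simp add: card_cartesian_product card_image Cons.IH)
qed

section \<open>Summation over all compositions\<close>

theorem theorem3p5:
  fixes k :: nat
  assumes "0 < k"
  shows "card {xs. odd_colored_composition k xs} =
    (\<Sum>w \<in> {w \<in> binary_strings k. hd w = 1}. \<Prod>r \<in> runs w. card r)"
proof -
  have bij: "bij_betw (alternating_word True) {ps. composition k ps}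
      {w \<in> binary_strings k. hd w = 1}"
    using bij_betw_alternating_word[OF assms, of True] by simp
  \<comment> \<open>Finiteness is pulled back along the bijection from the binary strings.\<close>
  then have fin: "finite {ps. composition k ps}"
    using bij_betw_finite finite_binary_strings by fastforce
  \<comment> \<open>A colored composition determines its parts through
    \<open>map fst\<close>.\<close>
  have disj: "colorings True ps \<inter> colorings True qs = {}" if "ps \<noteq> qs" for ps qs
    using that by (auto simp: colorings_def)
  have "{xs. odd_colored_composition k xs} = (\<Union>ps\<in>{ps. composition k ps}. colorings True ps)"
    by (auto simp: odd_colored_composition_def colorings_def)
  then have "card {xs. odd_colored_composition k xs} =
      (\<Sum>ps\<in>{ps. composition k ps}. card (colorings True ps))"
    using fin disj by (simp add: card_UN_disjoint finite_colorings)
  \<comment> \<open>Both summands equal \<open>alternating_prod True ps\<close>.\<close>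
  also have "\<dots> = (\<Sum>ps\<in>{ps. composition k ps}. \<Prod>r\<in>runs (alternating_word True ps). card r)"
    by (intro sum.cong)
      (auto simp: card_colorings prod_card_runs_alternating_word composition_def)
  also have "\<dots> = (\<Sum>w\<in>{w \<in> binary_strings k. hd w = 1}. \<Prod>r\<in>runs w. card r)"
    by (rule sum.reindex_bij_betw[OF bij])
  finally show ?thesis .
qed

end
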